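(* Let $(X,R)$ be a forcing network and let $G$ be an $X$-colored graph. Let $H_1,\dots,H_k$ be the partition of $G$ into maximal connected subgraphs each of whose vertex sets is monochromatic, and let $G'$ be the color-contracted graph of $G$: it has vertices $v_1,\dots,v_k$, with $v_i$ colored by the common color of $V(H_i)$, and $v_i,v_j$ ($i\ne j$) adjacent if and only if some vertex of $H_i$ is adjacent in $G$ to some vertex of $H_j$. Then, for the multi-color forcing process with propagation, the end state $\epsilon(\ell_0(G))$ of $G$ is obtained from the end state $\epsilon(\ell_0(G'))$ of $G'$ by giving every vertex of $H_i$ the color of $v_i$ in $\epsilon(\ell_0(G'))$, for each $i$.
   Context: Let $X\subseteq\{1,\dots,N\}$ be a finite set of colors. An $X$-colored graph is a finite simple graph together with an assignment of a color from $X$ to each vertex. A forcing network is a pair $(X,R)$ where $R=(r_1,\dots,r_m)$ is an ordered list of color change rules, each of the form $a\to b$ with $a,b\in X$, $a\ne b$. A forcing step with rule $a\to b$ means: simultaneously recolor with color $a$ every vertex of color $b$ that has at least one neighbor of color $a$. A propagating forcing step with rule $a\to b$ means performing forcing steps with this rule repeatedly until no vertex of color $b$ has a neighbor of color $a$. In the multi-color forcing process with propagation, the rules are applied as propagating forcing steps in the cyclic order $r_1,\dots,r_m,r_1,\dots$, until no rule $a\to b\in R$ has an edge joining a vertex of color $a$ and a vertex of color $b$. $\ell_0(G)$ denotes the initial coloring of $G$ and $\epsilon(\ell_0(G))$ the coloring at termination (the end state). *)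

theory Defs
  imports "Graph_Theory.Pair_Digraph" "Graph_Theory.Digraph_Component"
begin

text \<open>
  A finite simple graph is a \<open>pair_graph\<close>: finite, loop-free, symmetric arc relation.
  The pair \<open>(a, b)\<close> stands for the color change rule \<open>a \<rightarrow> b\<close>: color \<open>a\<close> forces color \<open>b\<close>.
  A coloring is a total function; its values outside the vertex set are irrelevant.
\<close>

type_synonym rule = "nat \<times> nat"

definition forcing_network :: "nat \<Rightarrow> nat set \<Rightarrow> rule list \<Rightarrow> bool" where
  "forcing_network N X R \<longleftrightarrow>
     X \<subseteq> {1..N} \<and> (\<forall>(a, b) \<in> set R. a \<in> X \<and> b \<in> X \<and> a \<noteq> b)"

definition colored_graph :: "nat set \<Rightarrow> 'a pair_pre_digraph \<Rightarrow> ('a \<Rightarrow> nat) \<Rightarrow> bool" where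
  "colored_graph X G c \<longleftrightarrow> pair_graph G \<and> c ` pverts G \<subseteq> X"


section \<open>The forcing process with propagation\<close>

definition forcing_step ::
    "'a pair_pre_digraph \<Rightarrow> rule \<Rightarrow> ('a \<Rightarrow> nat) \<Rightarrow> 'a \<Rightarrow> nat" where
  "forcing_step G = (\<lambda>(a, b) c u.
     if c u = b \<and> (\<exists>w. (u, w) \<in> parcs G \<and> c w = a) then a else c u)"

definition applicable :: "'a pair_pre_digraph \<Rightarrow> rule \<Rightarrow> ('a \<Rightarrow> nat) \<Rightarrow> bool" where
  "applicable G = (\<lambda>(a, b) c. \<exists>u w. (u, w) \<in> parcs G \<and> c u = b \<and> c w = a)"

definition propagating_step ::
    "'a pair_pre_digraph \<Rightarrow> rule \<Rightarrow> ('a \<Rightarrow> nat) \<Rightarrow> 'a \<Rightarrow> nat" where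
  "propagating_step G r c =
     (forcing_step G r ^^ (LEAST n. \<not> applicable G r ((forcing_step G r ^^ n) c))) c"

text \<open>
  The coloring after \<open>t\<close> propagating steps. List positions start at \<open>0\<close>. For an empty list
  of rules only \<open>t = 0\<close> matters, since the process then stops immediately.
\<close>

primrec process ::
    "'a pair_pre_digraph \<Rightarrow> rule list \<Rightarrow> ('a \<Rightarrow> nat) \<Rightarrow> nat \<Rightarrow> 'a \<Rightarrow> nat" where
  "process G R c 0 = c"
| "process G R c (Suc t) = propagating_step G (R ! (t mod length R)) (process G R c t)"

definition terminated :: "'a pair_pre_digraph \<Rightarrow> rule list \<Rightarrow> ('a \<Rightarrow> nat) \<Rightarrow> bool" where
  "terminated G R c \<longleftrightarrow> (\<forall>r \<in> set R. \<not> applicable G r c)"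

definition end_state ::
    "'a pair_pre_digraph \<Rightarrow> rule list \<Rightarrow> ('a \<Rightarrow> nat) \<Rightarrow> 'a \<Rightarrow> nat" where
  "end_state G R c = process G R c (LEAST t. terminated G R (process G R c t))"


section \<open>The color-contracted graph\<close>

definition monochromatic :: "('a \<Rightarrow> nat) \<Rightarrow> 'a set \<Rightarrow> bool" where
  "monochromatic c S \<longleftrightarrow> (\<forall>x \<in> S. \<forall>y \<in> S. c x = c y)"

definition color_components ::
    "'a pair_pre_digraph \<Rightarrow> ('a \<Rightarrow> nat) \<Rightarrow> 'a pair_pre_digraph set" where
  "color_components G c = {H. pre_digraph.max_subgraph (with_proj G)
     (\<lambda>K. connected K \<and> monochromatic c (verts K)) (with_proj H)}"

text \<open>
  \<open>(G', c')\<close> is the color-contracted graph of \<open>(G, c)\<close>, where \<open>H 1, \<dots>, H k\<close> enumerates the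
  color components without repetition and \<open>v i\<close> is the vertex that replaces \<open>H i\<close>.
\<close>

definition color_contraction ::
    "'a pair_pre_digraph \<Rightarrow> ('a \<Rightarrow> nat) \<Rightarrow> nat \<Rightarrow> (nat \<Rightarrow> 'a pair_pre_digraph) \<Rightarrow>
     (nat \<Rightarrow> 'b) \<Rightarrow> 'b pair_pre_digraph \<Rightarrow> ('b \<Rightarrow> nat) \<Rightarrow> bool" where
  "color_contraction G c k H v G' c' \<longleftrightarrow>
     bij_betw H {1..k} (color_components G c) \<and>
     inj_on v {1..k} \<and>
     pverts G' = v ` {1..k} \<and>
     parcs G' = {(v i, v j) | i j. i \<in> {1..k} \<and> j \<in> {1..k} \<and> i \<noteq> j \<and>
        (\<exists>x \<in> pverts (H i). \<exists>y \<in> pverts (H j). (x, y) \<in> parcs G)} \<and>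
     (\<forall>i \<in> {1..k}. \<forall>x \<in> pverts (H i). c' (v i) = c x)"


section \<open>Termination\<close>

text \<open>
  Both uses of \<open>LEAST\<close> above are meaningful: a propagating step stops because every forcing
  step that changes the coloring lowers the number of vertices of color \<open>b\<close>, and the process
  stops because every propagating step that changes the coloring lowers the number of
  bichromatic arcs.
\<close>

lemma forcing_step_terminates:
  assumes "pair_graph G" and "a \<noteq> b"
  shows "\<exists>n. \<not> applicable G (a, b) ((forcing_step G (a, b) ^^ n) c)"
proof (induction "card {u \<in> pverts G. c u = b}" arbitrary: c rule: less_induct)
  case less
  interpret pair_graph G by fact
  show ?case
  proof (cases "applicable G (a, b) c")
    case False
    then show ?thesis by (intro exI[of _ 0]) simp
  next
    case True
    let ?c = "forcing_step G (a, b) c"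
    from True obtain u w where uw: "(u, w) \<in> parcs G" "c u = b" "c w = a"
      by (auto simp: applicable_def)
    have "{u \<in> pverts G. ?c u = b} \<subset> {u \<in> pverts G. c u = b}"
    proof
      show "{u \<in> pverts G. ?c u = b} \<subseteq> {u \<in> pverts G. c u = b}"
        using assms(2) by (auto simp: forcing_step_def split: if_splits)
      have "?c u \<noteq> b" using uw assms(2) by (auto simp: forcing_step_def)
      moreover have "u \<in> pverts G" using uw in_arcsD1 by blast
      ultimately show "{u \<in> pverts G. ?c u = b} \<noteq> {u \<in> pverts G. c u = b}"
        using uw by blast
    qed
    then have "card {u \<in> pverts G. ?c u = b} < card {u \<in> pverts G. c u = b}"
      using pair_finite_verts by (intro psubset_card_mono) auto
    from less[OF this] obtain n where
      "\<not> applicable G (a, b) ((forcing_step G (a, b) ^^ n) ?c)" by blast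
    then show ?thesis by (intro exI[of _ "Suc n"]) (simp add: funpow_swap1)
  qed
qed

lemma propagating_step_not_applicable:
  assumes "pair_graph G" and "a \<noteq> b"
  shows "\<not> applicable G (a, b) (propagating_step G (a, b) c)"
  unfolding propagating_step_def by (rule LeastI_ex) (rule forcing_step_terminates[OF assms])

lemma propagating_step_cases:
  "propagating_step G (a, b) c u = c u \<or> c u = b \<and> propagating_step G (a, b) c u = a"
proof -
  have "(forcing_step G (a, b) ^^ n) c u = c u \<or> c u = b \<and> (forcing_step G (a, b) ^^ n) c u = a"
    for n by (induction n) (auto simp: forcing_step_def)
  then show ?thesis unfolding propagating_step_def by blast
qed

lemma propagating_step_idle:
  assumes "\<not> applicable G r c"
  shows "propagating_step G r c = c"
proof -
  have "(LEAST n. \<not> applicable G r ((forcing_step G r ^^ n) c)) = 0"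
    using assms by (intro Least_equality) auto
  then show ?thesis by (simp add: propagating_step_def)
qed

definition bichromatic_arcs :: "'a pair_pre_digraph \<Rightarrow> ('a \<Rightarrow> nat) \<Rightarrow> ('a \<times> 'a) set" where
  "bichromatic_arcs G c = {(u, w) \<in> parcs G. c u \<noteq> c w}"

lemma propagating_step_bichromatic:
  assumes G: "pair_graph G" and "a \<noteq> b"
  shows "bichromatic_arcs G (propagating_step G (a, b) c) \<subseteq> bichromatic_arcs G c"
    and "applicable G (a, b) c \<Longrightarrow>
      bichromatic_arcs G (propagating_step G (a, b) c) \<noteq> bichromatic_arcs G c"
proof -
  interpret pair_graph G by fact
  let ?c = "propagating_step G (a, b) c"
  have no: "\<not> (?c u = b \<and> ?c w = a)" if "(u, w) \<in> parcs G" for u w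
    using propagating_step_not_applicable[OF assms, of c] that by (auto simp: applicable_def)
  have same: "?c u = ?c w" if "(u, w) \<in> parcs G" "c u = c w" for u w
    using no[OF that(1)] no[OF arcs_symmetric[OF that(1)]] that(2)
      propagating_step_cases[of G a b c u] propagating_step_cases[of G a b c w] by metis
  then show "bichromatic_arcs G ?c \<subseteq> bichromatic_arcs G c"
    by (auto simp: bichromatic_arcs_def)
  assume "applicable G (a, b) c"
  then obtain u w where uw: "(u, w) \<in> parcs G" "c u = b" "c w = a"
    by (auto simp: applicable_def)
  have "?c u = ?c w"
    using no[OF uw(1)] uw assms(2)
      propagating_step_cases[of G a b c u] propagating_step_cases[of G a b c w] by metis
  then show "bichromatic_arcs G ?c \<noteq> bichromatic_arcs G c"
    using uw assms(2) by (auto simp: bichromatic_arcs_def)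
qed

lemma process_terminates:
  assumes net: "forcing_network N X R" and G: "pair_graph G"
  shows "\<exists>t. terminated G R (process G R c t)"
proof (rule ccontr)
  assume "\<nexists>t. terminated G R (process G R c t)"
  then have run: "\<not> terminated G R (process G R c t)" for t by blast
  interpret pair_graph G by fact
  let ?m = "length R"
  let ?f = "\<lambda>t. card (bichromatic_arcs G (process G R c t))"
  have pos: "?m > 0" using run[of 0] by (auto simp: terminated_def)
  have fin: "finite (bichromatic_arcs G d)" for d
    by (rule finite_subset[OF _ pair_finite_arcs]) (auto simp: bichromatic_arcs_def)
  have rule: "\<exists>a b. R ! (t mod ?m) = (a, b) \<and> a \<noteq> b" for t
  proof -
    have "R ! (t mod ?m) \<in> set R" using pos by simp
    moreover obtain a b where "R ! (t mod ?m) = (a, b)" by fastforce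
    ultimately show ?thesis using net by (auto simp: forcing_network_def)
  qed
  have step: "?f (Suc t) \<le> ?f t \<and>
      (applicable G (R ! (t mod ?m)) (process G R c t) \<longrightarrow> ?f (Suc t) < ?f t)" for t
  proof -
    obtain a b where ab: "R ! (t mod ?m) = (a, b)" "a \<noteq> b" using rule by blast
    from propagating_step_bichromatic[OF G ab(2), of "process G R c t"] fin show ?thesis
      by (auto simp: ab(1) intro: card_mono psubset_card_mono)
  qed
  have anti: "?f t \<le> ?f s" if "s \<le> t" for s t
    by (rule lift_Suc_antimono_le[OF _ that]) (rule conjunct1[OF step])
  have drop: "\<exists>s. ?f s < ?f t" for t
  proof (rule ccontr)
    assume "\<nexists>s. ?f s < ?f t"
    then have ge: "?f t \<le> ?f s" for s by (meson not_le)
    have idle: "\<not> applicable G (R ! (s mod ?m)) (process G R c s)" if "t \<le> s" for s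
      using step[of s] anti[OF that] ge[of "Suc s"] by linarith
    have const: "process G R c s = process G R c t" if "t \<le> s" for s
      using that
    proof (induction s rule: dec_induct)
      case (step n)
      then show ?case using propagating_step_idle[OF idle[OF step(1)]] by simp
    qed simp
    have "\<not> applicable G (R ! i) (process G R c t)" if "i < ?m" for i
    proof -
      have "t * 1 \<le> t * ?m" using pos by (intro mult_le_mono2) linarith
      then have "t \<le> t * ?m + i" by linarith
      from idle[OF this] const[OF this] show ?thesis using that by simp
    qed
    then have "terminated G R (process G R c t)"
      unfolding terminated_def by (metis in_set_conv_nth)
    with run show False by blast
  qed
  have "\<exists>s. ?f s < n" if "n \<le> ?f 0" for n
    using that
  proof (induction "?f 0 - n" arbitrary: n)
    case 0
    then show ?case using drop[of 0] by auto
  next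
    case (Suc j)
    then have "j = ?f 0 - Suc n" "Suc n \<le> ?f 0" by auto
    from Suc(1)[OF this] obtain s where s: "?f s < Suc n" by blast
    obtain s' where "?f s' < ?f s" using drop[of s] by blast
    with s have "?f s' < n" by linarith
    then show ?case by blast
  qed
  from this[of 0] show False by simp
qed

end

theory Submission
  imports Defs
begin

text \<open>
  The forcing process commutes with any surjection of graphs whose fibers are connected and
  monochromatic: a propagating step of \<open>a \<rightarrow> b\<close> recolors the least set of \<open>b\<close>-colored vertices
  that is closed under adjacency to color \<open>a\<close> or to the set itself, and by connectedness
  this set is a union of fibers that projects onto the corresponding set of the quotient. Hence
  both processes run in lockstep and stop at the same time. The color components are such fibers.
\<close>

section \<open>Propagating steps as a closure\<close>

text \<open>Everything refers to the starting coloring \<open>c\<close> and no step counter occurs.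
  This matters because a fiber may need several forcing steps where its image in the quotient needs
  one, so iterates cannot be compared step by step, whereas forced sets can.\<close>

inductive forced :: "'a pair_pre_digraph \<Rightarrow> nat \<Rightarrow> nat \<Rightarrow> ('a \<Rightarrow> nat) \<Rightarrow> 'a \<Rightarrow> bool"
  for G a b c where
  source: "(u, w) \<in> parcs G \<Longrightarrow> c u = b \<Longrightarrow> c w = a \<Longrightarrow> forced G a b c u"
| spread: "(u, w) \<in> parcs G \<Longrightarrow> c u = b \<Longrightarrow> forced G a b c w \<Longrightarrow> forced G a b c u"

lemma forced_color: "forced G a b c u \<Longrightarrow> c u = b"
  by (cases rule: forced.cases)

lemma forced_in_verts:
  assumes "pair_graph G" "forced G a b c u"
  shows "u \<in> pverts G"
proof -
  interpret pair_graph G by fact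
  show ?thesis using assms(2) by cases (auto dest: in_arcsD1)
qed

text \<open>By induction on the number of forcing steps, only forced vertices are ever recolored.
  Conversely, no arc between \<open>b\<close> and \<open>a\<close> survives in the final coloring,
  so color \<open>a\<close> must have traveled along every derivation of
  \<open>forced\<close>.\<close>

lemma propagating_step_forced:
  assumes "pair_graph G" "a \<noteq> b"
  shows "propagating_step G (a, b) c u = (if forced G a b c u then a else c u)"
proof -
  let ?d = "propagating_step G (a, b) c"
  have "(forcing_step G (a, b) ^^ n) c u = c u \<or>
      forced G a b c u \<and> (forcing_step G (a, b) ^^ n) c u = a" for n u
  proof (induction n arbitrary: u)
    case (Suc n)
    let ?e = "(forcing_step G (a, b) ^^ n) c"
    show ?case
    proof (cases "?e u = b \<and> (\<exists>w. (u, w) \<in> parcs G \<and> ?e w = a)")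
      case True
      then obtain w where w: "?e u = b" "(u, w) \<in> parcs G" "?e w = a" by blast
      \<comment> \<open>A vertex recolored earlier has color \<open>a\<close>, which differs from
        \<open>b\<close>, so \<open>u\<close> still carries its original color.\<close>
      have "c u = b" using Suc[of u] w(1) assms(2) by auto
      moreover have "c w = a \<or> forced G a b c w" using Suc[of w] w(3) by auto
      ultimately show ?thesis
        using True w(2) by (auto simp: forcing_step_def intro: forced.intros)
    next
      case False
      then have "(forcing_step G (a, b) ^^ Suc n) c u = ?e u"
        by (auto simp: forcing_step_def)
      then show ?thesis using Suc[of u] by metis
    qed
  qed simp
  then have unforced: "?d u = c u" if "\<not> forced G a b c u"
    using that unfolding propagating_step_def by blast
  have stable: "\<not> (?d x = b \<and> ?d y = a)" if "(x, y) \<in> parcs G" for x y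
    using propagating_step_not_applicable[OF assms] that unfolding applicable_def by blast
  have "?d x = a" if "forced G a b c x" for x
    using that
  proof induction
    case (source x w)
    then show ?case
      using stable propagating_step_cases[of G a b c x] propagating_step_cases[of G a b c w]
      by metis
  next
    case (spread x w)
    then show ?case using stable propagating_step_cases[of G a b c x] by metis
  qed
  with unforced show ?thesis by auto
qed


section \<open>Quotients with connected fibers\<close>

text \<open>Paths in \<open>fiber_connected\<close> stay inside one fiber. Colors are kept out of
  the locale: monochromatic fibers are part of the invariant \<open>lifts\<close>, and adjacent
  vertices of \<open>G'\<close> may share a color, as happens once forcing has merged
  components.\<close>

locale fibered_graph =
  G: pair_graph G + G': pair_graph G'
  for G :: "'a pair_pre_digraph" and G' :: "'b pair_pre_digraph" and p :: "'a \<Rightarrow> 'b" +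
  assumes arc_image: "(x, y) \<in> parcs G \<Longrightarrow> p x = p y \<or> (p x, p y) \<in> parcs G'"
    and arc_lift: "(i, j) \<in> parcs G' \<Longrightarrow> \<exists>x y. (x, y) \<in> parcs G \<and> p x = i \<and> p y = j"
    and fiber_connected: "x \<in> pverts G \<Longrightarrow> y \<in> pverts G \<Longrightarrow> p x = p y \<Longrightarrow>
      (x, y) \<in> {(x, y) \<in> parcs G. p x = p y}\<^sup>*"
begin

definition lifts :: "('b \<Rightarrow> nat) \<Rightarrow> ('a \<Rightarrow> nat) \<Rightarrow> bool" where
  "lifts c' c \<longleftrightarrow> (\<forall>x \<in> pverts G. c x = c' (p x))"

lemma lifts_arc:
  assumes "lifts c' c" "(x, y) \<in> parcs G"
  shows "c x = c' (p x)" "c y = c' (p y)"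
  using assms G.in_arcsD1 G.in_arcsD2 unfolding lifts_def by blast+

text \<open>An arc joining the distinct colors \<open>a\<close> and \<open>b\<close> cannot lie
  inside a monochromatic fiber, so it projects to an arc of \<open>G'\<close>;
  \<open>arc_lift\<close> gives the converse.\<close>

lemma applicable_lifts:
  assumes "lifts c' c" "a \<noteq> b"
  shows "applicable G (a, b) c \<longleftrightarrow> applicable G' (a, b) c'"
proof
  assume "applicable G (a, b) c"
  then obtain x y where xy: "(x, y) \<in> parcs G" "c x = b" "c y = a"
    by (auto simp: applicable_def)
  then have "c' (p x) = b" "c' (p y) = a" using lifts_arc[OF assms(1)] by metis+
  moreover from this have "(p x, p y) \<in> parcs G'"
    using arc_image[OF xy(1)] assms(2) by auto
  ultimately show "applicable G' (a, b) c'" by (auto simp: applicable_def)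
next
  assume "applicable G' (a, b) c'"
  then obtain i j where ij: "(i, j) \<in> parcs G'" "c' i = b" "c' j = a"
    by (auto simp: applicable_def)
  then obtain x y where xy: "(x, y) \<in> parcs G" "p x = i" "p y = j" using arc_lift by blast
  then have "c x = b" "c y = a" using ij lifts_arc[OF assms(1)] by metis+
  with xy show "applicable G (a, b) c" by (auto simp: applicable_def)
qed

text \<open>Going down, an arc inside a fiber changes nothing and any other arc projects to an arc
  of \<open>G'\<close>. Going up, a lifted arc forces one vertex of the fiber, and connectedness
  then spreads this over the whole fiber.\<close>

lemma forced_lifts:
  assumes "lifts c' c" "a \<noteq> b" "x \<in> pverts G"
  shows "forced G a b c x \<longleftrightarrow> forced G' a b c' (p x)"
proof
  assume "forced G a b c x"
  then show "forced G' a b c' (p x)"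
  proof induction
    case (source x y)
    then have c: "c' (p x) = b" "c' (p y) = a" using lifts_arc[OF assms(1)] by metis+
    moreover from this have "(p x, p y) \<in> parcs G'"
      using arc_image[OF source(1)] assms(2) by auto
    ultimately show ?case by (auto intro: forced.source)
  next
    case (spread x y)
    then have "c' (p x) = b" using lifts_arc[OF assms(1)] by metis
    with arc_image[OF spread(1)] spread.IH show ?case
      by (metis forced.spread)
  qed
next
  \<comment> \<open>Induction along a path in the fiber from \<open>x\<close> to \<open>y\<close>,
    read from its end: all its vertices share the color \<open>b\<close> of \<open>y\<close>, so
    \<open>spread\<close> applies at each arc.\<close>
  have fiber: "forced G a b c x" if "forced G a b c y" "x \<in> pverts G" "p x = p y" for x y
  proof -
    have "y \<in> pverts G" using forced_in_verts[OF G.pair_graph that(1)] .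
    then have "(x, y) \<in> {(x, y) \<in> parcs G. p x = p y}\<^sup>*" using fiber_connected that by blast
    then show ?thesis
    proof (induction rule: converse_rtrancl_induct)
      case base
      show ?case by fact
    next
      case (step x z)
      then have "c x = c z" using lifts_arc[OF assms(1)] by force
      with step show ?case using forced_color[OF step.IH] by (auto intro: forced.spread)
    qed
  qed
  \<comment> \<open>The induction must cover the entire fiber, since \<open>arc_lift\<close> may end
    at any vertex of the fiber of \<open>j\<close>.\<close>
  have "\<forall>x \<in> pverts G. p x = i \<longrightarrow> forced G a b c x" if "forced G' a b c' i" for i
    using that
  proof induction
    case (source i j)
    obtain x y where xy: "(x, y) \<in> parcs G" "p x = i" "p y = j"
      using arc_lift source(1) by blast
    then have "c x = b" "c y = a" using source lifts_arc[OF assms(1)] by metis+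
    with xy(1) have "forced G a b c x" by (rule forced.source)
    with xy(2) show ?case by (auto intro: fiber)
  next
    case (spread i j)
    obtain x y where xy: "(x, y) \<in> parcs G" "p x = i" "p y = j"
      using arc_lift spread(1) by blast
    moreover have "c x = b" using spread xy lifts_arc[OF assms(1)] by metis
    moreover have "forced G a b c y" using spread.IH xy G.in_arcsD2 by blast
    ultimately have "forced G a b c x" by (auto intro: forced.spread)
    with xy(2) show ?case by (auto intro: fiber)
  qed
  moreover assume "forced G' a b c' (p x)"
  ultimately show "forced G a b c x" using assms(3) by blast
qed

lemma propagating_step_lifts:
  assumes "lifts c' c" "a \<noteq> b"
  shows "lifts (propagating_step G' (a, b) c') (propagating_step G (a, b) c)"
  unfolding lifts_def
    propagating_step_forced[OF G.pair_graph assms(2)]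
    propagating_step_forced[OF G'.pair_graph assms(2)]
  using assms(1) forced_lifts[OF assms] by (auto simp: lifts_def)

lemma process_lifts:
  assumes "lifts c' c" "\<forall>(a, b) \<in> set R. a \<noteq> b" "R \<noteq> []"
  shows "lifts (process G' R c' t) (process G R c t)"
proof (induction t)
  case (Suc t)
  have "R ! (t mod length R) \<in> set R" using assms(3) by simp
  moreover obtain a b where "R ! (t mod length R) = (a, b)" by fastforce
  ultimately show ?case using assms(2) propagating_step_lifts[OF Suc] by auto
qed (simp add: assms(1))

text \<open>Under the invariant both termination tests agree at every time, so the two
  \<open>LEAST\<close> times coincide.\<close>

lemma end_state_lifts:
  assumes "lifts c' c" "\<forall>(a, b) \<in> set R. a \<noteq> b"
  shows "lifts (end_state G' R c') (end_state G R c)"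
proof (cases "R = []")
  \<comment> \<open>Without rules the process stops at time 0, so the unspecified value
    \<open>R ! (t mod length R)\<close> is never consulted.\<close>
  case True
  then show ?thesis using assms(1) by (simp add: end_state_def terminated_def Least_eq_0)
next
  case False
  note lift = process_lifts[OF assms False]
  have "terminated G R (process G R c t) \<longleftrightarrow> terminated G' R (process G' R c' t)" for t
    unfolding terminated_def using assms(2) applicable_lifts[OF lift] by fast
  then show ?thesis using lift by (simp add: end_state_def)
qed

end


section \<open>Color components\<close>

definition same_color :: "'a pair_pre_digraph \<Rightarrow> ('a \<Rightarrow> nat) \<Rightarrow> 'a rel" where
  "same_color G c = {(x, y) \<in> parcs G. c x = c y}"

text \<open>Explicit form of the color component through \<open>x\<close>: the subgraph induced on
  all vertices reachable from \<open>x\<close> along arcs that preserve color.\<close>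

definition color_component_of ::
    "'a pair_pre_digraph \<Rightarrow> ('a \<Rightarrow> nat) \<Rightarrow> 'a \<Rightarrow> 'a pair_pre_digraph" where
  "color_component_of G c x =
     (let S = (same_color G c)\<^sup>* `` {x} in \<lparr>pverts = S, parcs = parcs G \<inter> S \<times> S\<rparr>)"

lemma pverts_color_component_of [simp]:
    "pverts (color_component_of G c x) = (same_color G c)\<^sup>* `` {x}"
  and parcs_color_component_of [simp]:
    "parcs (color_component_of G c x) =
       parcs G \<inter> (same_color G c)\<^sup>* `` {x} \<times> (same_color G c)\<^sup>* `` {x}"
  by (simp_all add: color_component_of_def Let_def)

lemma same_color_reachable_color: "(x, y) \<in> (same_color G c)\<^sup>* \<Longrightarrow> c x = c y"
  by (induction rule: rtrancl_induct) (auto simp: same_color_def)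

context pair_graph
begin

lemma sym_same_color: "sym (same_color G c)"
  by (auto simp: same_color_def intro!: symI arcs_symmetric)

lemma subgraph_color_component_of:
  assumes "x \<in> pverts G"
  shows "subgraph (with_proj (color_component_of G c x)) (with_proj G)"
proof -
  have "y \<in> pverts G" if "(x, y) \<in> (same_color G c)\<^sup>*" for y
    using that assms by induction (auto simp: same_color_def dest: in_arcsD2)
  then show ?thesis
    by (auto simp: subgraph_def wf_digraph_wp_iff intro: wf_digraph_axioms) (unfold_locales, auto)
qed

lemma monochromatic_color_component_of:
  "monochromatic c (pverts (color_component_of G c x))"
  by (auto simp: monochromatic_def dest!: same_color_reachable_color)

text \<open>A color-preserving path from \<open>x\<close> never leaves the class of
  \<open>x\<close>; by symmetry any two vertices of the class are joined through
  \<open>x\<close>.\<close>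

lemma connected_color_component_of:
  "connected (with_proj (color_component_of G c x))"
proof -
  let ?S = "(same_color G c)\<^sup>* `` {x}"
  let ?E = "(parcs (color_component_of G c x))\<^sup>s"
  have reach: "(x, y) \<in> rtrancl_on ?S ?E" if "(x, y) \<in> (same_color G c)\<^sup>*" for y
    using that
  proof induction
    case (step y z)
    then have "z \<in> ?S" by (auto intro: rtrancl_into_rtrancl)
    moreover have "(y, z) \<in> ?E"
      using step \<open>z \<in> ?S\<close> by (auto simp: symcl_def same_color_def)
    ultimately show ?case using step.IH by (auto intro: rtrancl_on_into_rtrancl_on)
  qed auto
  have "sym (rtrancl_on ?S ?E)"
    by (intro rtrancl_on_sym symI) (auto simp: symcl_def)
  then have "(y, z) \<in> rtrancl_on ?S ?E" if "y \<in> ?S" "z \<in> ?S" for y z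
    using reach that by (meson Image_singleton_iff rtrancl_on_trans symD)
  then show ?thesis unfolding connected_conv by auto
qed

text \<open>A path in \<open>H\<close>, with arcs read in either direction, is a path in the
  symmetric graph \<open>G\<close> on which \<open>c\<close> is constant.\<close>

lemma connected_monochromatic_imp_reachable:
  assumes "subgraph H (with_proj G)" "connected H" "monochromatic c (verts H)"
    and "x \<in> verts H" "y \<in> verts H"
  shows "(x, y) \<in> (same_color G c)\<^sup>*"
proof -
  have "(x, y) \<in> rtrancl_on (verts H) ((arcs_ends H)\<^sup>s)"
    using assms(2,4,5) by (simp add: connected_conv)
  then show ?thesis
  proof (induction rule: rtrancl_on_induct)
    case (step y z)
    have "(y, z) \<in> parcs G"
      using step(2) arcs_ends_mono[OF assms(1)] arcs_symmetric by (auto simp: symcl_def)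
    moreover have "c y = c z" using assms(3) step(3,4) unfolding monochromatic_def by blast
    ultimately show ?case using step.IH by (auto simp: same_color_def intro: rtrancl_into_rtrancl)
  qed simp
qed

lemma subgraph_of_color_component_of:
  assumes H: "subgraph H (with_proj G)" "connected H" "monochromatic c (verts H)"
    and x: "x \<in> verts H"
  shows "subgraph H (with_proj (color_component_of G c x))"
proof (rule subgraphI)
  have "x \<in> pverts G" using H(1) x by (auto simp: subgraph_def)
  from subgraph_color_component_of[OF this]
  show "wf_digraph (with_proj (color_component_of G c x))" by blast
  show wf: "wf_digraph H" using H(1) by blast
  \<comment> \<open>Here \<open>H\<close> is a general digraph, as \<open>max_subgraph\<close>
    requires; compatibility with \<open>G\<close> makes its arcs genuine vertex pairs.\<close>
  have ends: "tail H = fst" "head H = snd" using H(1) by (auto simp: subgraph_def compatible_def)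
  then show "compatible (with_proj (color_component_of G c x)) H" by (simp add: compatible_def)
  have verts: "verts H \<subseteq> (same_color G c)\<^sup>* `` {x}"
    using connected_monochromatic_imp_reachable[OF H x] by auto
  then show "verts H \<subseteq> verts (with_proj (color_component_of G c x))" by simp
  have "e \<in> verts H \<times> verts H" if "e \<in> arcs H" for e
    using wf_digraph.wellformed[OF wf that] ends by (simp add: mem_Times_iff)
  moreover have "arcs H \<subseteq> parcs G" using H(1) by (auto simp: subgraph_def)
  moreover note Sigma_mono[OF verts verts]
  ultimately show "arcs H \<subseteq> arcs (with_proj (color_component_of G c x))"
    unfolding with_proj_simps parcs_color_component_of by blast
qed

lemma with_proj_eq_iff: "with_proj H = with_proj K \<longleftrightarrow> H = K"
  by (metis pair_pre_digraph.equality with_proj_simps(1,2) old.unit.exhaust)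

text \<open>Every connected monochromatic subgraph containing \<open>x\<close> lies inside
  \<open>color_component_of G c x\<close>, which is itself such a subgraph and hence the only
  maximal one through \<open>x\<close>.\<close>

lemma color_components_eq:
  "color_components G c = color_component_of G c ` pverts G"
proof (intro equalityI subsetI)
  fix H assume "H \<in> color_components G c"
  then have max: "max_subgraph (\<lambda>K. connected K \<and> monochromatic c (verts K)) (with_proj H)"
    by (simp add: color_components_def)
  then have H: "subgraph (with_proj H) (with_proj G)" "connected (with_proj H)"
      "monochromatic c (verts (with_proj H))"
    by (auto simp: max_subgraph_def)
  \<comment> \<open>Connectedness includes having at least one vertex.\<close>
  obtain x where x: "x \<in> pverts H" using H(2) by (auto simp: connected_conv)
  then have xG: "x \<in> pverts G" using H(1) by (auto simp: subgraph_def)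
  have "subgraph (with_proj H) (with_proj (color_component_of G c x))"
    using subgraph_of_color_component_of[OF H] x by simp
  moreover note subgraph_color_component_of[OF xG] connected_color_component_of
    monochromatic_color_component_of
  ultimately have "H = color_component_of G c x"
    using max unfolding max_subgraph_def by (metis with_proj_eq_iff with_proj_simps(1))
  with xG show "H \<in> color_component_of G c ` pverts G" by blast
next
  fix H assume "H \<in> color_component_of G c ` pverts G"
  then obtain x where x: "x \<in> pverts G" and H: "H = color_component_of G c x" by blast
  have "H' = with_proj H"
    if sub: "subgraph (with_proj H) H'" and H': "subgraph H' (with_proj G)" "connected H'"
      "monochromatic c (verts H')" for H'
  proof -
    have "x \<in> verts H'" using sub by (auto simp: H subgraph_def)
    then have "subgraph H' (with_proj H)"
      using subgraph_of_color_component_of[OF H'] by (simp add: H)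
    \<comment> \<open>Mutual inclusion fixes vertices and arcs, and compatibility fixes the tail and
      head maps.\<close>
    with sub show ?thesis by (auto simp: subgraph_def compatible_def)
  qed
  then show "H \<in> color_components G c"
    using subgraph_color_component_of[OF x] connected_color_component_of
      monochromatic_color_component_of
    by (auto simp: color_components_def max_subgraph_def H)
qed

end

text \<open>The map \<open>p\<close> sends a vertex to the \<open>v i\<close> that replaces its
  color component \<open>H i\<close>. The color components partition the vertices and are connected
  by color-preserving arcs, which makes them the fibers of \<open>p\<close>.\<close>

lemma color_contraction_fibered:
  assumes G: "pair_graph G" and contr: "color_contraction G c k H v G' c'"
  obtains p where "fibered_graph G G' p" "\<And>x. x \<in> pverts G \<Longrightarrow> c x = c' (p x)"
    "\<And>i x. i \<in> {1..k} \<Longrightarrow> x \<in> pverts (H i) \<Longrightarrow> x \<in> pverts G \<and> p x = v i"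
proof -
  interpret pair_graph G by fact
  have bij: "bij_betw H {1..k} (color_components G c)" and inj: "inj_on v {1..k}"
    and verts: "pverts G' = v ` {1..k}"
    and arcs: "parcs G' = {(v i, v j) | i j. i \<in> {1..k} \<and> j \<in> {1..k} \<and> i \<noteq> j \<and>
        (\<exists>x \<in> pverts (H i). \<exists>y \<in> pverts (H j). (x, y) \<in> parcs G)}"
    and col: "\<forall>i \<in> {1..k}. \<forall>x \<in> pverts (H i). c' (v i) = c x"
    using contr unfolding color_contraction_def by - (elim conjE, assumption)+
  let ?D = "same_color G c"
  \<comment> \<open>The class of a vertex does not depend on its representative, so
    \<open>H i\<close> is the component of each of its vertices.\<close>
  have fiber: "x \<in> pverts G" "pverts (H i) = ?D\<^sup>* `` {x}" "H i = color_component_of G c x"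
    if "i \<in> {1..k}" and x: "x \<in> pverts (H i)" for i x
  proof -
    have "H i \<in> color_components G c" using bij that(1) by (auto simp: bij_betw_def)
    then obtain y where y: "y \<in> pverts G" "H i = color_component_of G c y"
      unfolding color_components_eq by blast
    then show "x \<in> pverts G"
      using subgraph_color_component_of[OF y(1), of c] x by (auto simp: subgraph_def)
    have xy: "(y, x) \<in> ?D\<^sup>*" using x y by simp
    then have "(x, y) \<in> ?D\<^sup>*" using sym_rtrancl[OF sym_same_color] by (auto dest: symD)
    with xy have eq: "?D\<^sup>* `` {x} = ?D\<^sup>* `` {y}" by (auto intro: rtrancl_trans)
    then show "pverts (H i) = ?D\<^sup>* `` {x}" using y by simp
    show "H i = color_component_of G c x" using y eq by (simp add: color_component_of_def)
  qed
  have "\<exists>i. i \<in> {1..k} \<and> x \<in> pverts (H i)" if x: "x \<in> pverts G" for x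
  proof -
    have "color_component_of G c x \<in> H ` {1..k}"
      using x bij by (auto simp: bij_betw_def color_components_eq)
    then obtain i where "i \<in> {1..k}" "H i = color_component_of G c x" by auto
    then show ?thesis by auto
  qed
  then obtain q where q: "\<And>x. x \<in> pverts G \<Longrightarrow> q x \<in> {1..k} \<and> x \<in> pverts (H (q x))"
    by metis
  have q_fiber: "pverts (H (q x)) = ?D\<^sup>* `` {x}" if "x \<in> pverts G" for x
    using fiber(2) q[OF that] by blast
  \<comment> \<open>Two components sharing \<open>x\<close> are equal, and \<open>H\<close>
    enumerates without repetition, so the chosen index is the only one.\<close>
  have q_eq: "q x = i" if "i \<in> {1..k}" "x \<in> pverts (H i)" for i x
  proof -
    have "x \<in> pverts G" using fiber(1) that .
    then have "H (q x) = H i" using fiber(3) that q by metis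
    with \<open>x \<in> pverts G\<close> show ?thesis
      using bij that(1) q by (auto simp: bij_betw_def dest: inj_onD)
  qed
  have "pair_graph G'"
  proof
    show "finite (pverts G')" by (simp add: verts)
    show fst_snd: "fst e \<in> pverts G'" "snd e \<in> pverts G'" if "e \<in> parcs G'" for e
      using that by (auto simp: verts arcs)
    have "parcs G' \<subseteq> pverts G' \<times> pverts G'" by (auto simp: verts arcs)
    then show "finite (parcs G')" by (rule finite_subset) (simp add: verts)
    show "fst e \<noteq> snd e" if "e \<in> parcs G'" for e
      using that by (auto simp: arcs inj_on_eq_iff[OF inj])
    have "(w, u) \<in> parcs G'" if "(u, w) \<in> parcs G'" for u w
      using that arcs_symmetric unfolding arcs by blast
    then show "symmetric (with_proj G')" by (auto simp: symmetric_def intro: symI)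
  qed
  then interpret G': pair_graph G' .
  have "fibered_graph G G' (v \<circ> q)"
  proof
    fix x y assume xy: "(x, y) \<in> parcs G"
    then have "x \<in> pverts G" "y \<in> pverts G" using in_arcsD1 in_arcsD2 by blast+
    then have "q x \<in> {1..k}" "x \<in> pverts (H (q x))" "q y \<in> {1..k}" "y \<in> pverts (H (q y))"
      using q by blast+
    then have "((v \<circ> q) x, (v \<circ> q) y) \<in> parcs G'" if "q x \<noteq> q y"
      using that xy unfolding arcs comp_def by blast
    then show "(v \<circ> q) x = (v \<circ> q) y \<or> ((v \<circ> q) x, (v \<circ> q) y) \<in> parcs G'" by (cases "q x = q y") auto
  next
    fix i' j' assume "(i', j') \<in> parcs G'"
    then obtain i j x y where "i' = v i" "j' = v j" "i \<in> {1..k}" "j \<in> {1..k}"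
      "x \<in> pverts (H i)" "y \<in> pverts (H j)" "(x, y) \<in> parcs G"
      unfolding arcs by blast
    then show "\<exists>x y. (x, y) \<in> parcs G \<and> (v \<circ> q) x = i' \<and> (v \<circ> q) y = j'"
      using q_eq by (intro exI[of _ x] exI[of _ y]) simp
  next
    fix x y assume xy: "x \<in> pverts G" "y \<in> pverts G" "(v \<circ> q) x = (v \<circ> q) y"
    then have "q x = q y" using inj_onD[OF inj, of "q x" "q y"] q by simp
    then have "(x, y) \<in> ?D\<^sup>*" using q[OF xy(2)] q_fiber[OF xy(1)] by simp
    then show "(x, y) \<in> {(x, y) \<in> parcs G. (v \<circ> q) x = (v \<circ> q) y}\<^sup>*"
    \<comment> \<open>It suffices that each color-preserving arc has both ends in one component,
      hence in one fiber.\<close>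
    proof (elim rtrancl_mono[THEN subsetD, rotated], intro subsetI)
      fix e assume "e \<in> ?D"
      then obtain u w where e: "e = (u, w)" "(u, w) \<in> ?D" by (cases e) auto
      then have "u \<in> pverts G" by (auto simp: same_color_def dest: in_arcsD1)
      then have "w \<in> pverts (H (q u))" using q_fiber e by auto
      then have "q w = q u" using q_eq q \<open>u \<in> pverts G\<close> by blast
      then show "e \<in> {(x, y) \<in> parcs G. (v \<circ> q) x = (v \<circ> q) y}"
        using e by (auto simp: same_color_def)
    qed
  qed
  moreover have "c x = c' ((v \<circ> q) x)" if "x \<in> pverts G" for x
    using q[OF that] col by auto
  moreover have "x \<in> pverts G \<and> (v \<circ> q) x = v i" if "i \<in> {1..k}" "x \<in> pverts (H i)" for i x
    using fiber(1)[OF that] q_eq[OF that] by simp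
  ultimately show thesis by (rule that)
qed

theorem theorem3p8:
  fixes N k :: nat and X :: "nat set" and R :: "(nat \<times> nat) list"
    and G :: "'a pair_pre_digraph" and l0 :: "'a \<Rightarrow> nat"
    and H :: "nat \<Rightarrow> 'a pair_pre_digraph" and v :: "nat \<Rightarrow> 'b"
    and G' :: "'b pair_pre_digraph" and l0' :: "'b \<Rightarrow> nat"
  assumes "forcing_network N X R"
    and "colored_graph X G l0"
    and "color_contraction G l0 k H v G' l0'"
  shows "\<forall>i \<in> {1..k}. \<forall>x \<in> pverts (H i). end_state G R l0 x = end_state G' R l0' (v i)"
proof -
  have "pair_graph G" using assms(2) by (simp add: colored_graph_def)
  then obtain p where p: "fibered_graph G G' p" "\<And>x. x \<in> pverts G \<Longrightarrow> l0 x = l0' (p x)"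
    "\<And>i x. i \<in> {1..k} \<Longrightarrow> x \<in> pverts (H i) \<Longrightarrow> x \<in> pverts G \<and> p x = v i"
    using color_contraction_fibered[OF _ assms(3)] by metis
  interpret fibered_graph G G' p by fact
  \<comment> \<open>The invariant holds initially because each \<open>v i\<close> starts with the
    common color of \<open>H i\<close>.\<close>
  have "lifts (end_state G' R l0') (end_state G R l0)"
    using p(2) assms(1) by (intro end_state_lifts) (auto simp: lifts_def forcing_network_def)
  then show ?thesis using p(3) by (auto simp: lifts_def)
qed

end
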